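(* Let $S\subseteq\mathbb{H}$ and suppose $g:S\to\mathbb{H}$ has the left GHR derivative at an interior point $q$ of the set $S$. Let $T\subseteq\mathbb{H}$ be such that $g(q)\in T$ for all $q\in S$. Assume $f:T\to\mathbb{H}$ has left GHR derivatives at an inner point $g(q)\in T$. Then the left GHR derivatives of the composite function $f(g(q))$ are as follows: $$\frac{\partial f(g(q))}{\partial q^{\mu}}=\frac{\partial f}{\partial g^{\nu}}\frac{\partial g^{\nu}}{\partial q^{\mu}}+\frac{\partial f}{\partial g^{\nu i}}\frac{\partial g^{\nu i}}{\partial q^{\mu}}+\frac{\partial f}{\partial g^{\nu j}}\frac{\partial g^{\nu j}}{\partial q^{\mu}}+\frac{\partial f}{\partial g^{\nu k}}\frac{\partial g^{\nu k}}{\partial q^{\mu}},$$ $$\frac{\partial f(g(q))}{\partial q^{\mu*}}=\frac{\partial f}{\partial g^{\nu}}\frac{\partial g^{\nu}}{\partial q^{\mu*}}+\frac{\partial f}{\partial g^{\nu i}}\frac{\partial g^{\nu i}}{\partial q^{\mu*}}+\frac{\partial f}{\partial g^{\nu j}}\frac{\partial g^{\nu j}}{\partial q^{\mu*}}+\frac{\partial f}{\partial g^{\nu k}}\frac{\partial g^{\nu k}}{\partial q^{\mu*}},$$ and $$\frac{\partial f(g(q))}{\partial q^{\mu}}=\frac{\partial f}{\partial g^{\nu*}}\frac{\partial g^{\nu*}}{\partial q^{\mu}}+\frac{\partial f}{\partial g^{\nu i*}}\frac{\partial g^{\nu i*}}{\partial q^{\mu}}+\frac{\partial f}{\partial g^{\nu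 j*}}\frac{\partial g^{\nu j*}}{\partial q^{\mu}}+\frac{\partial f}{\partial g^{\nu k*}}\frac{\partial g^{\nu k*}}{\partial q^{\mu}},$$ $$\frac{\partial f(g(q))}{\partial q^{\mu*}}=\frac{\partial f}{\partial g^{\nu*}}\frac{\partial g^{\nu*}}{\partial q^{\mu*}}+\frac{\partial f}{\partial g^{\nu i*}}\frac{\partial g^{\nu i*}}{\partial q^{\mu*}}+\frac{\partial f}{\partial g^{\nu j*}}\frac{\partial g^{\nu j*}}{\partial q^{\mu*}}+\frac{\partial f}{\partial g^{\nu k*}}\frac{\partial g^{\nu k*}}{\partial q^{\mu*}},$$ where $\mu,\nu\in\mathbb{H}$, $\mu\nu\neq0$.
   Context: $\mathbb{H}$ denotes the real quaternions $q=q_a+iq_b+jq_c+kq_d$ with $q_a,q_b,q_c,q_d\in\mathbb{R}$ and $i^2=j^2=k^2=ijk=-1$. The conjugate is $q^*=q_a-iq_b-jq_c-kq_d$. For $\mu\in\mathbb{H}$, $\mu\ne0$, and $p\in\mathbb{H}$, write $p^{\mu}:=\mu p\mu^{-1}$ and $p^{\mu*}:=(p^{\mu})^*$; a product in the exponent, such as $p^{\nu i}$, means rotation by the quaternion product $\nu i$, and $p^{\nu i*}=(p^{\nu i})^*$. For a function $g$, $g^{\nu}$ is the function $p\mapsto (g(p))^{\nu}$ and $g^{\nu*}$ the function $p\mapsto (g(p))^{\nu*}$. An $\mathbb{H}$-valued function $f$ is regarded as a function of the four real variables $q_a,q_b,q_c,q_d$, with ($\mathbb{H}$-valued) partial derivatives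 $\frac{\partial f}{\partial q_a},\dots,\frac{\partial f}{\partial q_d}$. For $\mu\neq0$ the left GHR derivatives of $f$ with respect to $q^{\mu}$ and $q^{\mu*}$ are $$\frac{\partial f}{\partial q^{\mu}}=\frac14\left(\frac{\partial f}{\partial q_a}-\frac{\partial f}{\partial q_b}i^{\mu}-\frac{\partial f}{\partial q_c}j^{\mu}-\frac{\partial f}{\partial q_d}k^{\mu}\right),\qquad \frac{\partial f}{\partial q^{\mu*}}=\frac14\left(\frac{\partial f}{\partial q_a}+\frac{\partial f}{\partial q_b}i^{\mu}+\frac{\partial f}{\partial q_c}j^{\mu}+\frac{\partial f}{\partial q_d}k^{\mu}\right).$$ The symbols $\frac{\partial f}{\partial g^{\nu}}$, $\frac{\partial f}{\partial g^{\nu*}}$ (and likewise with $\nu i,\nu j,\nu k$) denote the left GHR derivatives of $f$ with respect to its own variable, with parameter $\nu$, evaluated at the point $g(q)$.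
   Formalization: The formal theorem additionally assumes that f is real differentiable (as a function of four real variables) at g(q); with mere existence of the left GHR derivatives of f the composite may have no partial derivatives and the claim fails. *)

theory Defs
  imports "HOL-Analysis.Analysis"
begin

section \<open>The real quaternions\<close>

datatype quat = Quat (qa: real) (qb: real) (qc: real) (qd: real)

lemma quat_eq_iff: "x = y \<longleftrightarrow> qa x = qa y \<and> qb x = qb y \<and> qc x = qc y \<and> qd x = qd y"
  by (cases x; cases y) simp

instantiation quat :: real_vector
begin

definition zero_quat :: quat where "0 = Quat 0 0 0 0"

definition plus_quat :: "quat \<Rightarrow> quat \<Rightarrow> quat" where
  "x + y = Quat (qa x + qa y) (qb x + qb y) (qc x + qc y) (qd x + qd y)"

definition uminus_quat :: "quat \<Rightarrow> quat" where
  "- x = Quat (- qa x) (- qb x) (- qc x) (- qd x)"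

definition minus_quat :: "quat \<Rightarrow> quat \<Rightarrow> quat" where
  "x - y = Quat (qa x - qa y) (qb x - qb y) (qc x - qc y) (qd x - qd y)"

definition scaleR_quat :: "real \<Rightarrow> quat \<Rightarrow> quat" where
  "r *\<^sub>R x = Quat (r * qa x) (r * qb x) (r * qc x) (r * qd x)"

instance
  by standard
    (simp_all add: zero_quat_def plus_quat_def uminus_quat_def minus_quat_def scaleR_quat_def
      quat_eq_iff algebra_simps)

end

lemma quat_sel_linear [simp]:
  "qa 0 = 0" "qb 0 = 0" "qc 0 = 0" "qd 0 = 0"
  "qa (x + y) = qa x + qa y" "qb (x + y) = qb x + qb y"
  "qc (x + y) = qc x + qc y" "qd (x + y) = qd x + qd y"
  "qa (- x) = - qa x" "qb (- x) = - qb x" "qc (- x) = - qc x" "qd (- x) = - qd x"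
  "qa (x - y) = qa x - qa y" "qb (x - y) = qb x - qb y"
  "qc (x - y) = qc x - qc y" "qd (x - y) = qd x - qd y"
  "qa (r *\<^sub>R x) = r * qa x" "qb (r *\<^sub>R x) = r * qb x"
  "qc (r *\<^sub>R x) = r * qc x" "qd (r *\<^sub>R x) = r * qd x"
  by (simp_all add: zero_quat_def plus_quat_def uminus_quat_def minus_quat_def scaleR_quat_def)

instantiation quat :: real_inner
begin

definition inner_quat :: "quat \<Rightarrow> quat \<Rightarrow> real" where
  "inner x y = qa x * qa y + qb x * qb y + qc x * qc y + qd x * qd y"

definition norm_quat :: "quat \<Rightarrow> real" where
  "norm x = sqrt ((qa x)\<^sup>2 + (qb x)\<^sup>2 + (qc x)\<^sup>2 + (qd x)\<^sup>2)"

definition sgn_quat :: "quat \<Rightarrow> quat" where "sgn (x::quat) = x /\<^sub>R norm x"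

definition dist_quat :: "quat \<Rightarrow> quat \<Rightarrow> real" where "dist (x::quat) y = norm (x - y)"

definition uniformity_quat :: "(quat \<times> quat) filter" where
  "uniformity = (INF e\<in>{0 <..}. principal {(x::quat, y). dist x y < e})"

definition open_quat :: "quat set \<Rightarrow> bool" where
  "open (U::quat set) = (\<forall>x\<in>U. eventually (\<lambda>(x', y). x' = x \<longrightarrow> y \<in> U) uniformity)"

instance
proof
  fix x y z :: quat and r :: real and U :: "quat set"
  show "dist x y = norm (x - y)" by (rule dist_quat_def)
  show "sgn x = x /\<^sub>R norm x" by (rule sgn_quat_def)
  show "uniformity = (INF e\<in>{0 <..}. principal {(x, y). dist (x::quat) y < e})"
    by (rule uniformity_quat_def)
  show "open (U::quat set) = (\<forall>x\<in>U. eventually (\<lambda>(x', y). x' = x \<longrightarrow> y \<in> U) uniformity)"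
    by (rule open_quat_def)
  show "inner x y = inner y x" by (simp add: inner_quat_def mult.commute)
  show "inner (x + y) z = inner x z + inner y z" by (simp add: inner_quat_def algebra_simps)
  show "inner (r *\<^sub>R x) y = r * inner x y" by (simp add: inner_quat_def algebra_simps)
  show "0 \<le> inner x x" by (simp add: inner_quat_def)
  show "inner x x = 0 \<longleftrightarrow> x = 0"
    by (simp add: inner_quat_def quat_eq_iff add_nonneg_eq_0_iff)
  show "norm x = sqrt (inner x x)" by (simp add: norm_quat_def inner_quat_def power2_eq_square)
qed

end

instantiation quat :: real_normed_div_algebra
begin

definition one_quat :: quat where "1 = Quat 1 0 0 0"

definition times_quat :: "quat \<Rightarrow> quat \<Rightarrow> quat" where
  "x * y = Quat
     (qa x * qa y - qb x * qb y - qc x * qc y - qd x * qd y)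
     (qa x * qb y + qb x * qa y + qc x * qd y - qd x * qc y)
     (qa x * qc y - qb x * qd y + qc x * qa y + qd x * qb y)
     (qa x * qd y + qb x * qc y - qc x * qb y + qd x * qa y)"

definition inverse_quat :: "quat \<Rightarrow> quat" where
  "inverse x = Quat (qa x) (- qb x) (- qc x) (- qd x) /\<^sub>R (norm x)\<^sup>2"

definition divide_quat :: "quat \<Rightarrow> quat \<Rightarrow> quat" where "x div (y::quat) = x * inverse y"

instance
proof
  fix x y z :: quat and r :: real
  show "x * y * z = x * (y * z)" by (simp add: times_quat_def algebra_simps)
  show "(x + y) * z = x * z + y * z" by (simp add: times_quat_def quat_eq_iff algebra_simps)
  show "x * (y + z) = x * y + x * z" by (simp add: times_quat_def quat_eq_iff algebra_simps)
  show "1 * x = x" "x * 1 = x" by (simp_all add: times_quat_def one_quat_def)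
  show "(0::quat) \<noteq> 1" by (simp add: one_quat_def zero_quat_def)
  show "r *\<^sub>R x * y = r *\<^sub>R (x * y)" "x * r *\<^sub>R y = r *\<^sub>R (x * y)"
    by (simp_all add: times_quat_def quat_eq_iff algebra_simps)
  have sq: "(norm u)\<^sup>2 = (qa u)\<^sup>2 + (qb u)\<^sup>2 + (qc u)\<^sup>2 + (qd u)\<^sup>2" for u :: quat
    by (simp add: norm_quat_def)
  show "inverse x * x = 1" "x * inverse x = 1" if "x \<noteq> 0"
  proof -
    have "(norm x)\<^sup>2 \<noteq> 0" using that by simp
    moreover have "x * Quat (qa x) (- qb x) (- qc x) (- qd x) = (norm x)\<^sup>2 *\<^sub>R 1"
      "Quat (qa x) (- qb x) (- qc x) (- qd x) * x = (norm x)\<^sup>2 *\<^sub>R 1"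
      unfolding sq by (simp_all add: times_quat_def one_quat_def quat_eq_iff power2_eq_square)
    ultimately show "inverse x * x = 1" "x * inverse x = 1"
      by (simp_all add: inverse_quat_def times_quat_def one_quat_def quat_eq_iff field_simps)
  qed
  show "x div y = x * inverse y" by (rule divide_quat_def)
  show "inverse (0::quat) = 0" by (simp add: inverse_quat_def quat_eq_iff)
  have "(norm (x * y))\<^sup>2 = (norm x * norm y)\<^sup>2"
    unfolding power_mult_distrib sq by (simp add: times_quat_def power2_eq_square algebra_simps)
  then show "norm (x * y) = norm x * norm y" by (simp add: power2_eq_iff_nonneg)
qed

end

definition qi :: quat where "qi = Quat 0 1 0 0"
definition qj :: quat where "qj = Quat 0 0 1 0"
definition qk :: quat where "qk = Quat 0 0 0 1"

lemma quat_units: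
  "qi * qi = - 1" "qj * qj = - 1" "qk * qk = - 1" "qi * qj * qk = - 1"
  by (simp_all add: qi_def qj_def qk_def times_quat_def one_quat_def uminus_quat_def)

lemma quat_expand: "q = qa q *\<^sub>R 1 + qb q *\<^sub>R qi + qc q *\<^sub>R qj + qd q *\<^sub>R qk"
  by (simp add: quat_eq_iff qi_def qj_def qk_def one_quat_def)

definition qcnj :: "quat \<Rightarrow> quat" where
  "qcnj q = Quat (qa q) (- qb q) (- qc q) (- qd q)"

text \<open>\<^term>\<open>qrot \<mu> p\<close> is the rotation $p^\mu$, and \<^term>\<open>qcnj (qrot \<mu> p)\<close> is $p^{\mu*}$.\<close>

definition qrot :: "quat \<Rightarrow> quat \<Rightarrow> quat" where
  "qrot \<mu> p = \<mu> * p * inverse \<mu>"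

section \<open>Left GHR derivatives\<close>

text \<open>
  Functions on a subset of the quaternions are represented by total functions; at an interior
  point of the subset, everything below depends only on the values on the subset.
  For \<^term>\<open>e\<close> in \<open>{1, qi, qj, qk}\<close>, \<open>qpartial e f q\<close> is the partial derivative of \<open>f\<close> with respect
  to the real coordinate \<open>qa\<close>, \<open>qb\<close>, \<open>qc\<close>, \<open>qd\<close>, respectively.
\<close>

definition qpartial :: "quat \<Rightarrow> (quat \<Rightarrow> quat) \<Rightarrow> quat \<Rightarrow> quat" where
  "qpartial e f q = vector_derivative (\<lambda>t. f (q + t *\<^sub>R e)) (at 0)"

text \<open>
  The four partial derivatives exist; this is exactly what is needed for the left GHR derivatives
  to be defined, for any parameter \<open>\<mu>\<close>. It does not imply real differentiability of \<open>f\<close> as a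
  function of four variables, which a chain rule for \<open>f \<circ> g\<close> needs of \<open>f\<close>. Where they do not exist, the value of \<^const>\<open>qpartial\<close> is meaningless.
\<close>

definition has_left_GHR :: "(quat \<Rightarrow> quat) \<Rightarrow> quat \<Rightarrow> bool" where
  "has_left_GHR f q \<longleftrightarrow>
     (\<forall>e\<in>{1, qi, qj, qk}. (\<lambda>t::real. f (q + t *\<^sub>R e)) differentiable (at 0))"

text \<open>
  \<open>GHR f \<mu> q\<close> and \<open>GHR_cnj f \<mu> q\<close> are the left GHR derivatives of \<open>f\<close> with respect to
  $q^\mu$ and $q^{\mu*}$, evaluated at \<open>q\<close>.
\<close>

definition GHR :: "(quat \<Rightarrow> quat) \<Rightarrow> quat \<Rightarrow> quat \<Rightarrow> quat" where
  "GHR f \<mu> q = (1/4) *\<^sub>R (qpartial 1 f q - qpartial qi f q * qrot \<mu> qi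
                         - qpartial qj f q * qrot \<mu> qj - qpartial qk f q * qrot \<mu> qk)"

definition GHR_cnj :: "(quat \<Rightarrow> quat) \<Rightarrow> quat \<Rightarrow> quat \<Rightarrow> quat" where
  "GHR_cnj f \<mu> q = (1/4) *\<^sub>R (qpartial 1 f q + qpartial qi f q * qrot \<mu> qi
                             + qpartial qj f q * qrot \<mu> qj + qpartial qk f q * qrot \<mu> qk)"

end

theory Submission
  imports Defs
begin

text \<open>
  Write \<open>u\<close> for a running element of the units \<open>1, i, j, k\<close> and \<open>f\<^sub>u\<close> for the partial derivative of
  \<open>f\<close> in the direction \<open>u\<close>. Both kinds of left GHR derivative are then a sum of the same shape: up to
  the factor \<open>1/4\<close>, they are \<open>\<Sum>u. f\<^sub>u * qrot \<nu> (qcnj u)\<close> and \<open>\<Sum>u. f\<^sub>u * qrot \<nu> u\<close>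
  (\<open>GHR_eq_sum\<close>, \<open>GHR_cnj_eq_sum\<close>).

  The theorem rests on one identity: averaging a quaternion \<open>x\<close> over the four rotations
  by units kills its imaginary part, \<open>\<Sum>e. qrot e x = 4 * qa x\<close> (\<open>sum_qrot_units\<close>). Rotations are
  multiplicative, so when the GHR derivatives with parameters \<open>\<nu> * e\<close> are multiplied by the rotated
  increments \<open>qrot (\<nu> * e) h\<close> and added up, the sum over \<open>e\<close> acts on the product \<open>qcnj u * h\<close>, whose
  real part is the coordinate of \<open>h\<close> along \<open>u\<close>. What remains is \<open>\<Sum>u. f\<^sub>u * inner u h\<close>, the
  real differential of \<open>f\<close> applied to \<open>h\<close> (\<open>GHR_differential\<close>). The real part of \<open>u * qcnj h\<close>
  is the same coordinate, which gives the conjugated version (\<open>GHR_cnj_differential\<close>).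

  By the real chain rule, the partial derivative of \<open>f \<circ> g\<close> in each direction is the differential of
  \<open>f\<close> at the partial derivative of \<open>g\<close>. Rotation and conjugation are real linear and so commute with
  partial derivatives; hence each partial derivative of \<open>f \<circ> g\<close> is
  \<open>\<Sum>e. A\<^sub>e * (partial derivative of the rotated g)\<close>, with the same left coefficients \<open>A\<^sub>e\<close> in
  all directions. Left GHR derivatives multiply partial derivatives on the right only, so
  they respect such combinations (\<open>GHR_left_linear\<close>), and this is the chain rule.
\<close>

section \<open>Rotations and conjugation\<close>

abbreviation qunits :: "quat set" where "qunits \<equiv> {1, qi, qj, qk}"

lemma qunits_distinct:
  "1 \<noteq> qi" "1 \<noteq> qj" "1 \<noteq> qk" "qi \<noteq> qj" "qi \<noteq> qk" "qj \<noteq> qk"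
  by (simp_all add: one_quat_def qi_def qj_def qk_def)

lemma sum_qunits: "(\<Sum>u\<in>qunits. F u) = F 1 + F qi + F qj + (F qk :: 'a::comm_monoid_add)"
  using qunits_distinct by (simp add: add.assoc)

lemma qunits_nonzero: "u \<in> qunits \<Longrightarrow> u \<noteq> 0"
  by (auto simp: zero_quat_def one_quat_def qi_def qj_def qk_def)

lemma bounded_linear_qrot: "bounded_linear (qrot \<mu>)"
  unfolding qrot_def
  by (intro bounded_linear_mult_const bounded_linear_const_mult bounded_linear_ident)

lemma norm_qcnj: "norm (qcnj x) = norm x"
  by (simp add: qcnj_def norm_quat_def)

lemma bounded_linear_qcnj: "bounded_linear qcnj"
  by (rule bounded_linear_intro[where K = 1])
    (simp_all add: norm_qcnj, simp_all add: qcnj_def quat_eq_iff)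

lemma qrot_mult: "\<mu> \<noteq> 0 \<Longrightarrow> qrot \<mu> (x * y) = qrot \<mu> x * qrot \<mu> y"
  unfolding qrot_def by (metis left_inverse mult.assoc mult.right_neutral)

lemma qrot_qrot: "\<mu> \<noteq> 0 \<Longrightarrow> \<nu> \<noteq> 0 \<Longrightarrow> qrot (\<mu> * \<nu>) x = qrot \<mu> (qrot \<nu> x)"
  by (simp add: qrot_def nonzero_inverse_mult_distrib mult.assoc)

lemma qrot_of_real: "\<mu> \<noteq> 0 \<Longrightarrow> qrot \<mu> (of_real r) = of_real r"
  by (simp add: qrot_def of_real_def)

lemma qcnj_qcnj: "qcnj (qcnj x) = x"
  by (simp add: qcnj_def quat_eq_iff)

lemma qcnj_scaleR: "qcnj (r *\<^sub>R x) = r *\<^sub>R qcnj x"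
  by (simp add: qcnj_def quat_eq_iff)

lemma qcnj_mult: "qcnj (x * y) = qcnj y * qcnj x"
  by (simp add: qcnj_def times_quat_def)

text \<open>
  The inverse of \<open>\<mu>\<close> is a real multiple of \<open>qcnj \<mu>\<close>, so a rotation is a real multiple of the symmetric
  product \<open>\<mu> * x * qcnj \<mu>\<close>; reversing and conjugating its factors only changes \<open>x\<close> into \<open>qcnj x\<close>.
\<close>
lemma qcnj_qrot: "qcnj (qrot \<mu> x) = qrot \<mu> (qcnj x)"
proof -
  have "inverse \<mu> = qcnj \<mu> /\<^sub>R (norm \<mu>)\<^sup>2"
    by (simp add: inverse_quat_def qcnj_def)
  then show ?thesis
    by (simp add: qrot_def qcnj_mult qcnj_scaleR qcnj_qcnj mult.assoc)
qed

text \<open>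
  Conjugation by \<open>i\<close> fixes \<open>1\<close> and \<open>i\<close> and negates \<open>j\<close> and \<open>k\<close>, and similarly for the other units: each
  imaginary coordinate is kept twice and negated twice, while the real one is kept four times.
\<close>
lemma sum_qrot_units: "(\<Sum>e\<in>qunits. qrot e x) = of_real (4 * qa x)"
  unfolding sum_qunits
  by (simp add: qrot_def times_quat_def inverse_quat_def norm_quat_def of_real_def
      one_quat_def qi_def qj_def qk_def quat_eq_iff)

lemma sum_qrot_mult_units:
  assumes "\<nu> \<noteq> 0"
  shows "(\<Sum>e\<in>qunits. qrot (\<nu> * e) x) = of_real (4 * qa x)"
proof -
  have "(\<Sum>e\<in>qunits. qrot (\<nu> * e) x) = (\<Sum>e\<in>qunits. qrot \<nu> (qrot e x))"
    using assms qunits_nonzero by (intro sum.cong refl qrot_qrot) auto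
  also have "\<dots> = qrot \<nu> (\<Sum>e\<in>qunits. qrot e x)"
    by (rule linear_sum[symmetric]) (rule bounded_linear.linear[OF bounded_linear_qrot])
  finally show ?thesis
    by (simp only: sum_qrot_units qrot_of_real[OF assms])
qed

lemma qa_qcnj_mult: "qa (qcnj x * y) = inner x y"
  by (simp add: qcnj_def times_quat_def inner_quat_def)

lemma qa_mult_qcnj: "qa (x * qcnj y) = inner x y"
  by (simp add: qcnj_def times_quat_def inner_quat_def)

section \<open>GHR derivatives and the real differential\<close>

lemma GHR_eq_sum:
  "GHR f \<mu> q = (1/4) *\<^sub>R (\<Sum>u\<in>qunits. qpartial u f q * qrot \<mu> (qcnj u))" if "\<mu> \<noteq> 0"
proof -
  have "qcnj 1 = 1" "qcnj qi = - qi" "qcnj qj = - qj" "qcnj qk = - qk"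
    by (simp_all add: qcnj_def one_quat_def qi_def qj_def qk_def uminus_quat_def)
  then show ?thesis
    using that unfolding GHR_def sum_qunits by (simp add: qrot_def)
qed

lemma GHR_cnj_eq_sum:
  "GHR_cnj f \<mu> q = (1/4) *\<^sub>R (\<Sum>u\<in>qunits. qpartial u f q * qrot \<mu> u)" if "\<mu> \<noteq> 0"
  using that unfolding GHR_cnj_def sum_qunits by (simp add: qrot_def)

text \<open>
  The common core of \<open>GHR_differential\<close> (with \<open>c = qcnj\<close>) and \<open>GHR_cnj_differential\<close> (with
  \<open>c u = u\<close> and \<open>qcnj h\<close> for \<open>h\<close>): rotations are multiplicative, so exchanging the two
  sums leaves, for each \<open>u\<close>, the average of the rotations of \<open>c u * h\<close>, a real number.
\<close>
lemma sum_GHR_shape: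
  assumes "\<nu> \<noteq> 0"
  shows "(\<Sum>e\<in>qunits. (1/4) *\<^sub>R (\<Sum>u\<in>qunits. p u * qrot (\<nu> * e) (c u)) * qrot (\<nu> * e) h)
       = (\<Sum>u\<in>qunits. qa (c u * h) *\<^sub>R p u)"
proof -
  have "(\<Sum>e\<in>qunits. (1/4) *\<^sub>R (\<Sum>u\<in>qunits. p u * qrot (\<nu> * e) (c u)) * qrot (\<nu> * e) h)
      = (\<Sum>e\<in>qunits. \<Sum>u\<in>qunits. (1/4) *\<^sub>R (p u * qrot (\<nu> * e) (c u * h)))"
  proof (rule sum.cong[OF refl])
    fix e assume "e \<in> qunits"
    then have nz: "\<nu> * e \<noteq> 0" using assms qunits_nonzero by simp
    show "(1/4) *\<^sub>R (\<Sum>u\<in>qunits. p u * qrot (\<nu> * e) (c u)) * qrot (\<nu> * e) h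
        = (\<Sum>u\<in>qunits. (1/4) *\<^sub>R (p u * qrot (\<nu> * e) (c u * h)))"
      by (simp only: mult_scaleR_left sum_distrib_right scaleR_sum_right qrot_mult[OF nz] mult.assoc)
  qed
  also have "\<dots> = (\<Sum>u\<in>qunits. \<Sum>e\<in>qunits. (1/4) *\<^sub>R (p u * qrot (\<nu> * e) (c u * h)))"
    by (rule sum.swap)
  also have "\<dots> = (\<Sum>u\<in>qunits. (1/4) *\<^sub>R (p u * (\<Sum>e\<in>qunits. qrot (\<nu> * e) (c u * h))))"
    by (simp only: sum_distrib_left scaleR_sum_right)
  also have "\<dots> = (\<Sum>u\<in>qunits. qa (c u * h) *\<^sub>R p u)"
    unfolding sum_qrot_mult_units[OF assms] by (simp add: of_real_def)
  finally show ?thesis .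
qed

lemma linear_eq_sum_units:
  assumes "linear D"
  shows "D h = (\<Sum>u\<in>qunits. inner u h *\<^sub>R D u)"
proof -
  have "D h = D (qa h *\<^sub>R 1 + qb h *\<^sub>R qi + qc h *\<^sub>R qj + qd h *\<^sub>R qk)"
    using quat_expand[of h] by simp
  also have "\<dots> = (\<Sum>u\<in>qunits. inner u h *\<^sub>R D u)"
    unfolding sum_qunits
    by (simp add: linear_add[OF assms] linear_scale[OF assms])
       (simp add: inner_quat_def one_quat_def qi_def qj_def qk_def)
  finally show ?thesis .
qed

lemma has_derivative_imp_line:
  assumes "(f has_derivative D) (at x)"
  shows "((\<lambda>t. f (x + t *\<^sub>R e)) has_vector_derivative D e) (at 0)"
proof -
  have "((\<lambda>t. x + t *\<^sub>R e) has_vector_derivative e) (at 0)"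
    by (auto intro!: derivative_eq_intros)
  then have "((f \<circ> (\<lambda>t. x + t *\<^sub>R e)) has_vector_derivative D e) (at 0)"
    using assms by (intro vector_derivative_diff_chain_within) (auto intro: has_derivative_at_withinI)
  then show ?thesis by (simp add: o_def)
qed

lemma qpartial_eqI:
  "((\<lambda>t. f (q + t *\<^sub>R e)) has_vector_derivative d) (at 0) \<Longrightarrow> qpartial e f q = d"
  unfolding qpartial_def by (rule vector_derivative_at)

lemma has_derivative_eq_sum_qpartial:
  assumes "(f has_derivative D) (at x)"
  shows "D h = (\<Sum>u\<in>qunits. inner u h *\<^sub>R qpartial u f x)"
  unfolding qpartial_eqI[OF has_derivative_imp_line[OF assms]]
  by (rule linear_eq_sum_units[OF has_derivative_linear[OF assms]])

lemma GHR_differential: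
  assumes "(f has_derivative D) (at x)" and "\<nu> \<noteq> 0"
  shows "D h = (\<Sum>e\<in>qunits. GHR f (\<nu> * e) x * qrot (\<nu> * e) h)"
proof -
  have "(\<Sum>e\<in>qunits. GHR f (\<nu> * e) x * qrot (\<nu> * e) h)
      = (\<Sum>e\<in>qunits. (1/4) *\<^sub>R (\<Sum>u\<in>qunits. qpartial u f x * qrot (\<nu> * e) (qcnj u))
          * qrot (\<nu> * e) h)"
  proof (rule sum.cong[OF refl])
    fix e assume "e \<in> qunits"
    then have nz: "\<nu> * e \<noteq> 0" using assms(2) qunits_nonzero by simp
    show "GHR f (\<nu> * e) x * qrot (\<nu> * e) h
        = (1/4) *\<^sub>R (\<Sum>u\<in>qunits. qpartial u f x * qrot (\<nu> * e) (qcnj u)) * qrot (\<nu> * e) h"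
      by (simp only: GHR_eq_sum[OF nz])
  qed
  also have "\<dots> = (\<Sum>u\<in>qunits. qa (qcnj u * h) *\<^sub>R qpartial u f x)"
    by (rule sum_GHR_shape[OF assms(2)])
  also have "\<dots> = D h"
    by (simp only: qa_qcnj_mult has_derivative_eq_sum_qpartial[OF assms(1), of h])
  finally show ?thesis by (rule sym)
qed

lemma GHR_cnj_differential:
  assumes "(f has_derivative D) (at x)" and "\<nu> \<noteq> 0"
  shows "D h = (\<Sum>e\<in>qunits. GHR_cnj f (\<nu> * e) x * qcnj (qrot (\<nu> * e) h))"
proof -
  have "(\<Sum>e\<in>qunits. GHR_cnj f (\<nu> * e) x * qcnj (qrot (\<nu> * e) h))
      = (\<Sum>e\<in>qunits. (1/4) *\<^sub>R (\<Sum>u\<in>qunits. qpartial u f x * qrot (\<nu> * e) u)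
          * qrot (\<nu> * e) (qcnj h))"
  proof (rule sum.cong[OF refl])
    fix e assume "e \<in> qunits"
    then have nz: "\<nu> * e \<noteq> 0" using assms(2) qunits_nonzero by simp
    show "GHR_cnj f (\<nu> * e) x * qcnj (qrot (\<nu> * e) h)
        = (1/4) *\<^sub>R (\<Sum>u\<in>qunits. qpartial u f x * qrot (\<nu> * e) u) * qrot (\<nu> * e) (qcnj h)"
      by (simp only: GHR_cnj_eq_sum[OF nz] qcnj_qrot)
  qed
  also have "\<dots> = (\<Sum>u\<in>qunits. qa (u * qcnj h) *\<^sub>R qpartial u f x)"
    by (rule sum_GHR_shape[OF assms(2)])
  also have "\<dots> = D h"
    by (simp only: qa_mult_qcnj has_derivative_eq_sum_qpartial[OF assms(1), of h])
  finally show ?thesis by (rule sym)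
qed

section \<open>The chain rule\<close>

lemma has_left_GHR_line:
  assumes "has_left_GHR g q" and "e \<in> qunits"
  shows "((\<lambda>t. g (q + t *\<^sub>R e)) has_vector_derivative qpartial e g q) (at 0)"
proof -
  have "(\<lambda>t. g (q + t *\<^sub>R e)) differentiable (at 0)"
    using assms unfolding has_left_GHR_def by (rule bspec)
  then show ?thesis
    unfolding qpartial_def by (rule vector_derivative_works[THEN iffD1])
qed

text \<open>
  Along a coordinate line through \<open>q\<close> the inner function is a curve, and its velocity vector is a partial
  derivative of \<open>g\<close>; the chain rule for a differentiable map along a curve applies.
\<close>
lemma qpartial_compose:
  assumes "(f has_derivative D) (at (g q))" and "has_left_GHR g q" and "e \<in> qunits"
  shows "((\<lambda>t. f (g (q + t *\<^sub>R e))) has_vector_derivative D (qpartial e g q)) (at 0)"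
proof -
  have "((f \<circ> (\<lambda>t. g (q + t *\<^sub>R e))) has_vector_derivative D (qpartial e g q)) (at 0)"
    using has_left_GHR_line[OF assms(2,3)] assms(1)
    by (intro vector_derivative_diff_chain_within) (auto intro: has_derivative_at_withinI)
  then show ?thesis by (simp add: o_def)
qed

lemma qpartial_bounded_linear:
  assumes "bounded_linear L" and "has_left_GHR g q" and "e \<in> qunits"
  shows "qpartial e (\<lambda>p. L (g p)) q = L (qpartial e g q)"
  by (rule qpartial_eqI, rule bounded_linear.has_vector_derivative[OF assms(1)],
      rule has_left_GHR_line[OF assms(2,3)])

text \<open>
  The units \<open>qrot \<mu> u\<close> stand to the right of the partial derivatives, so coefficients on the left
  factor out despite the lack of commutativity.
\<close>
lemma GHR_left_linear:
  assumes "\<And>u. u \<in> qunits \<Longrightarrow> qpartial u F q = (\<Sum>e\<in>R. A e * qpartial u (G e) q)"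
  shows "GHR F \<mu> q = (\<Sum>e\<in>R. A e * GHR (G e) \<mu> q)"
    and "GHR_cnj F \<mu> q = (\<Sum>e\<in>R. A e * GHR_cnj (G e) \<mu> q)"
proof -
  have *: "qpartial u F q * c = (\<Sum>e\<in>R. A e * (qpartial u (G e) q * c))" if "u \<in> qunits" for u c
    by (simp only: assms[OF that] sum_distrib_right mult.assoc)
  have one: "qpartial 1 F q = (\<Sum>e\<in>R. A e * qpartial 1 (G e) q)"
    by (rule assms) simp
  show "GHR F \<mu> q = (\<Sum>e\<in>R. A e * GHR (G e) \<mu> q)"
    unfolding GHR_def one *[of qi, simplified] *[of qj, simplified] *[of qk, simplified]
    by (simp only: mult_scaleR_right scaleR_sum_right[symmetric] right_diff_distrib sum_subtractf)
  show "GHR_cnj F \<mu> q = (\<Sum>e\<in>R. A e * GHR_cnj (G e) \<mu> q)"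
    unfolding GHR_cnj_def one *[of qi, simplified] *[of qj, simplified] *[of qk, simplified]
    by (simp only: mult_scaleR_right scaleR_sum_right[symmetric] distrib_left sum.distrib)
qed

text \<open>
  Any family of real linear maps \<open>L e\<close> that reconstructs the differential of \<open>f\<close> from left
  coefficients \<open>A e\<close> yields a chain rule; the four formulas of the theorem are instances.
\<close>
lemma GHR_chain:
  assumes D: "(f has_derivative D) (at (g q))" and g: "has_left_GHR g q"
    and L: "\<And>e. bounded_linear (L e)"
    and rep: "\<And>h. D h = (\<Sum>e\<in>R. A e * L e h)"
  shows "GHR (\<lambda>p. f (g p)) \<mu> q = (\<Sum>e\<in>R. A e * GHR (\<lambda>p. L e (g p)) \<mu> q)"
    and "GHR_cnj (\<lambda>p. f (g p)) \<mu> q = (\<Sum>e\<in>R. A e * GHR_cnj (\<lambda>p. L e (g p)) \<mu> q)"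
proof -
  have *: "qpartial u (\<lambda>p. f (g p)) q = (\<Sum>e\<in>R. A e * qpartial u (\<lambda>p. L e (g p)) q)"
    if "u \<in> qunits" for u
    using qpartial_eqI[OF qpartial_compose[OF D g that]]
    by (simp only: rep qpartial_bounded_linear[OF L g that])
  show "GHR (\<lambda>p. f (g p)) \<mu> q = (\<Sum>e\<in>R. A e * GHR (\<lambda>p. L e (g p)) \<mu> q)"
    by (rule GHR_left_linear(1)[OF *])
  show "GHR_cnj (\<lambda>p. f (g p)) \<mu> q = (\<Sum>e\<in>R. A e * GHR_cnj (\<lambda>p. L e (g p)) \<mu> q)"
    by (rule GHR_left_linear(2)[OF *])
qed

theorem theorem3p7:
  fixes f g :: "quat \<Rightarrow> quat" and S T :: "quat set" and q \<mu> \<nu> :: quat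
  assumes "q \<in> interior S"
    and "has_left_GHR g q"
    and "\<forall>p\<in>S. g p \<in> T"
    and "g q \<in> interior T"
    and "has_left_GHR f (g q)"
    and "f differentiable (at (g q))"
    and "\<mu> * \<nu> \<noteq> 0"
  shows "has_left_GHR (\<lambda>p. f (g p)) q
    \<and> GHR (\<lambda>p. f (g p)) \<mu> q =
        GHR f \<nu> (g q) * GHR (\<lambda>p. qrot \<nu> (g p)) \<mu> q
      + GHR f (\<nu> * qi) (g q) * GHR (\<lambda>p. qrot (\<nu> * qi) (g p)) \<mu> q
      + GHR f (\<nu> * qj) (g q) * GHR (\<lambda>p. qrot (\<nu> * qj) (g p)) \<mu> q
      + GHR f (\<nu> * qk) (g q) * GHR (\<lambda>p. qrot (\<nu> * qk) (g p)) \<mu> q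
    \<and> GHR_cnj (\<lambda>p. f (g p)) \<mu> q =
        GHR f \<nu> (g q) * GHR_cnj (\<lambda>p. qrot \<nu> (g p)) \<mu> q
      + GHR f (\<nu> * qi) (g q) * GHR_cnj (\<lambda>p. qrot (\<nu> * qi) (g p)) \<mu> q
      + GHR f (\<nu> * qj) (g q) * GHR_cnj (\<lambda>p. qrot (\<nu> * qj) (g p)) \<mu> q
      + GHR f (\<nu> * qk) (g q) * GHR_cnj (\<lambda>p. qrot (\<nu> * qk) (g p)) \<mu> q
    \<and> GHR (\<lambda>p. f (g p)) \<mu> q =
        GHR_cnj f \<nu> (g q) * GHR (\<lambda>p. qcnj (qrot \<nu> (g p))) \<mu> q
      + GHR_cnj f (\<nu> * qi) (g q) * GHR (\<lambda>p. qcnj (qrot (\<nu> * qi) (g p))) \<mu> q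
      + GHR_cnj f (\<nu> * qj) (g q) * GHR (\<lambda>p. qcnj (qrot (\<nu> * qj) (g p))) \<mu> q
      + GHR_cnj f (\<nu> * qk) (g q) * GHR (\<lambda>p. qcnj (qrot (\<nu> * qk) (g p))) \<mu> q
    \<and> GHR_cnj (\<lambda>p. f (g p)) \<mu> q =
        GHR_cnj f \<nu> (g q) * GHR_cnj (\<lambda>p. qcnj (qrot \<nu> (g p))) \<mu> q
      + GHR_cnj f (\<nu> * qi) (g q) * GHR_cnj (\<lambda>p. qcnj (qrot (\<nu> * qi) (g p))) \<mu> q
      + GHR_cnj f (\<nu> * qj) (g q) * GHR_cnj (\<lambda>p. qcnj (qrot (\<nu> * qj) (g p))) \<mu> q
      + GHR_cnj f (\<nu> * qk) (g q) * GHR_cnj (\<lambda>p. qcnj (qrot (\<nu> * qk) (g p))) \<mu> q"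
proof -
  obtain D where D: "(f has_derivative D) (at (g q))"
    using assms(6) by (auto simp: differentiable_def)
  have \<nu>: "\<nu> \<noteq> 0" using assms(7) by auto
  have "has_left_GHR (\<lambda>p. f (g p)) q"
    unfolding has_left_GHR_def
    by (intro ballI differentiableI_vector, rule qpartial_compose[OF D assms(2)])
  moreover note
    GHR_chain[OF D assms(2) bounded_linear_qrot GHR_differential[OF D \<nu>], of \<mu>]
    GHR_chain[OF D assms(2) bounded_linear_compose[OF bounded_linear_qcnj bounded_linear_qrot]
      GHR_cnj_differential[OF D \<nu>], of \<mu>]
  ultimately show ?thesis
    unfolding sum_qunits mult_1_right by (intro conjI)
qed

end
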